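(* Let $A, B \in \mathbb{P}$. Then the following are equivalent: (1) $A^{-1} \natural B \leq I$; (2) $A \natural B^{-1} \geq I$; (3) $A \# B \leq A$; (4) $A \# B \geq B$; (5) $B \leq A$.
   Context: $\mathcal{H}$ is a Hilbert space, $B(\mathcal{H})$ is the space of bounded linear operators on $\mathcal{H}$, $I$ is the identity operator, and $\mathbb{P} \subset B(\mathcal{H})$ is the open convex cone of positive definite (that is, self-adjoint, positive and invertible) operators. For self-adjoint $X, Y$, $X \leq Y$ means that $Y - X$ is positive semi-definite (Loewner order). For $A, B \in \mathbb{P}$ the geometric mean is $A \# B := A^{1/2} (A^{-1/2} B A^{-1/2})^{1/2} A^{1/2}$ and the spectral geometric mean is $A \natural B := (A^{-1} \# B)^{1/2} A (A^{-1} \# B)^{1/2}$. Powers of positive definite operators are taken by functional calculus. *)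

theory Defs
  imports "HOL-Analysis.Analysis" "HOL-Computational_Algebra.Polynomial"
begin

section \<open>Complex Hilbert spaces\<close>

text \<open>The inner product \<open>cinner\<close> is linear in its first and antilinear in its second
  argument. The real vector space, inner product and norm of the superclass \<^class>\<open>real_inner\<close>
  are the ones underlying the complex structure: by \<open>Re_cinner\<close> the norm satisfies
  \<open>(norm x)\<^sup>2 = Re (cinner x x) = cinner x x\<close>.\<close>

class complex_inner = real_inner +
  fixes scaleC :: "complex \<Rightarrow> 'a \<Rightarrow> 'a" (infixr "*\<^sub>C" 75)
    and cinner :: "'a \<Rightarrow> 'a \<Rightarrow> complex"
  assumes scaleC_add_right: "c *\<^sub>C (x + y) = c *\<^sub>C x + c *\<^sub>C y"
    and scaleC_add_left: "(c + d) *\<^sub>C x = c *\<^sub>C x + d *\<^sub>C x"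
    and scaleC_scaleC: "c *\<^sub>C (d *\<^sub>C x) = (c * d) *\<^sub>C x"
    and scaleC_of_real: "complex_of_real r *\<^sub>C x = r *\<^sub>R x"
    and cinner_commute: "cinner x y = cnj (cinner y x)"
    and cinner_add_left: "cinner (x + y) z = cinner x z + cinner y z"
    and cinner_scaleC_left: "cinner (c *\<^sub>C x) y = c * cinner x y"
    and Re_cinner: "Re (cinner x y) = inner x y"

class complex_hilbert = complex_inner + complete_space


section \<open>Bounded operators\<close>

text \<open>The type \<open>'a \<Rightarrow>\<^sub>L 'a\<close> consists of the bounded \<^emph>\<open>real\<close>-linear operators;
  \<open>B(H)\<close> is its subset of complex-linear ones, with the same operator norm.\<close>

definition bounded_ops :: "('a::complex_hilbert \<Rightarrow>\<^sub>L 'a) set" where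
  "bounded_ops = {T. \<forall>c x. blinfun_apply T (c *\<^sub>C x) = c *\<^sub>C blinfun_apply T x}"

definition is_inverse :: "('a::complex_hilbert \<Rightarrow>\<^sub>L 'a) \<Rightarrow> ('a \<Rightarrow>\<^sub>L 'a) \<Rightarrow> bool" where
  "is_inverse T S \<longleftrightarrow> S \<in> bounded_ops \<and> T o\<^sub>L S = id_blinfun \<and> S o\<^sub>L T = id_blinfun"

definition op_invertible :: "('a::complex_hilbert \<Rightarrow>\<^sub>L 'a) \<Rightarrow> bool" where
  "op_invertible T \<longleftrightarrow> (\<exists>S. is_inverse T S)"

definition op_inverse :: "('a::complex_hilbert \<Rightarrow>\<^sub>L 'a) \<Rightarrow> ('a \<Rightarrow>\<^sub>L 'a)" where
  "op_inverse T = (THE S. is_inverse T S)"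

definition self_adjoint :: "('a::complex_hilbert \<Rightarrow>\<^sub>L 'a) \<Rightarrow> bool" where
  "self_adjoint T \<longleftrightarrow> T \<in> bounded_ops \<and>
     (\<forall>x y. cinner (blinfun_apply T x) y = cinner x (blinfun_apply T y))"

text \<open>For self-adjoint \<open>T\<close> the number \<open>cinner (T x) x\<close> is real.\<close>

definition pos_semidef :: "('a::complex_hilbert \<Rightarrow>\<^sub>L 'a) \<Rightarrow> bool" where
  "pos_semidef T \<longleftrightarrow> self_adjoint T \<and> (\<forall>x. 0 \<le> Re (cinner (blinfun_apply T x) x))"

definition pos_def :: "('a::complex_hilbert \<Rightarrow>\<^sub>L 'a) set" where
  "pos_def = {T. pos_semidef T \<and> op_invertible T}"

definition loewner_le :: "('a::complex_hilbert \<Rightarrow>\<^sub>L 'a) \<Rightarrow> ('a \<Rightarrow>\<^sub>L 'a) \<Rightarrow> bool"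
    (infix "\<preceq>" 50) where
  "X \<preceq> Y \<longleftrightarrow> pos_semidef (Y - X)"


section \<open>Continuous functional calculus\<close>

text \<open>Real points of the spectrum; for self-adjoint \<open>T\<close> this is the whole spectrum.\<close>

definition real_spectrum :: "('a::complex_hilbert \<Rightarrow>\<^sub>L 'a) \<Rightarrow> real set" where
  "real_spectrum T = {t. \<not> op_invertible (T - t *\<^sub>R id_blinfun)}"

definition poly_op :: "real poly \<Rightarrow> ('a::complex_hilbert \<Rightarrow>\<^sub>L 'a) \<Rightarrow> ('a \<Rightarrow>\<^sub>L 'a)" where
  "poly_op p T = (\<Sum>i\<le>degree p. coeff p i *\<^sub>R (((o\<^sub>L) T ^^ i) id_blinfun))"

text \<open>For self-adjoint \<open>T\<close> and \<open>f\<close> real-valued and continuous on the spectrum of \<open>T\<close>,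
  \<open>f(T)\<close> is the norm limit of \<open>p\<^sub>n(T)\<close> for any polynomials \<open>p\<^sub>n\<close> converging to \<open>f\<close>
  uniformly on the spectrum. Such \<open>p\<^sub>n\<close> exist by the Weierstrass theorem, and the limit does
  not depend on their choice because the norm of \<open>p(T)\<close> is the supremum of \<open>\<bar>p\<bar>\<close> over the spectrum.\<close>

definition fun_calc :: "(real \<Rightarrow> real) \<Rightarrow> ('a::complex_hilbert \<Rightarrow>\<^sub>L 'a) \<Rightarrow> ('a \<Rightarrow>\<^sub>L 'a)" where
  "fun_calc f T = (THE S. \<forall>p :: nat \<Rightarrow> real poly.
     uniform_limit (real_spectrum T) (\<lambda>n. poly (p n)) f sequentially \<longrightarrow>
     (\<lambda>n. poly_op (p n) T) \<longlonglongrightarrow> S)"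

definition op_powr :: "('a::complex_hilbert \<Rightarrow>\<^sub>L 'a) \<Rightarrow> real \<Rightarrow> ('a \<Rightarrow>\<^sub>L 'a)" where
  "op_powr T r = fun_calc (\<lambda>t. t powr r) T"


section \<open>Operator means\<close>

definition geometric_mean ::
    "('a::complex_hilbert \<Rightarrow>\<^sub>L 'a) \<Rightarrow> ('a \<Rightarrow>\<^sub>L 'a) \<Rightarrow> ('a \<Rightarrow>\<^sub>L 'a)" (infixl "\<sharp>" 70) where
  "A \<sharp> B = op_powr A (1/2)
     o\<^sub>L op_powr (op_powr A (-1/2) o\<^sub>L B o\<^sub>L op_powr A (-1/2)) (1/2)
     o\<^sub>L op_powr A (1/2)"

definition spectral_geometric_mean ::
    "('a::complex_hilbert \<Rightarrow>\<^sub>L 'a) \<Rightarrow> ('a \<Rightarrow>\<^sub>L 'a) \<Rightarrow> ('a \<Rightarrow>\<^sub>L 'a)" (infixl "\<natural>" 70) where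
  "A \<natural> B = op_powr (op_inverse A \<sharp> B) (1/2) o\<^sub>L A o\<^sub>L op_powr (op_inverse A \<sharp> B) (1/2)"

end

(* For the geometric mean G and W = G^(-1/2) A G^(-1/2), inversion symmetry
   A^(-1) # B^(-1) = G^(-1) identifies the two spectral geometric means with W^(-1) and W, so (1)
   and (2) both say I <= W, which is (3) after congruence by G^(1/2).  Congruence by A^(1/2) turns
   (3), (4), (5) into D <= I, D^2 <= D, D^2 <= I for D = (A^(-1/2) B A^(-1/2))^(1/2).
   What makes the functional calculus well behaved is that the norm of p(T) is at most the supremum
   of |p| over the spectrum: if p^2 were strictly below l^2 = norm (p(T))^2 there, p(T)^2 - l^2 would
   be invertible, since the real quadratic factors without real roots are strongly monotone at T. *)

theory Submission
  imports Defs "HOL-Computational_Algebra.Fundamental_Theorem_Algebra"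
begin

text \<open>Powers are definite descriptions: they denote only once some sequence of polynomials
  approximates the function on the spectrum and all such sequences lead to the same operator limit.
  The norm bound supplies both, so it has to precede the algebra of means. The zero space belongs to
  the type class and has empty spectrum, so the failure of p(T)^2 - l^2 to be invertible takes the
  form: if it is invertible, every vector is 0. Positive definiteness is used as a uniform positive
  lower bound of the quadratic form; it keeps the spectrum away from 0, where negative powers are
  singular. Nested powers such as (T^(-1))^(1/2) are identified through uniqueness of the positive
  square root. The passage from D^2 <= I to D <= I is Cauchy-Schwarz combined with norm (D x) <=
  norm x.\<close>

instance complex_hilbert \<subseteq> banach ..

section \<open>Operators through the real inner product\<close>

lemma norm_scaleC: "norm (c *\<^sub>C x) = cmod c * norm (x::'a::complex_inner)"
proof -
  have *: "cinner (c *\<^sub>C x) (c *\<^sub>C x) = c * cnj c * cinner x x"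
    by (subst cinner_scaleC_left, subst cinner_commute, subst cinner_scaleC_left)
      (simp add: cinner_commute[of x x, symmetric])
  have "(norm (c *\<^sub>C x))\<^sup>2 = Re (c * cnj c * cinner x x)"
    unfolding *[symmetric] Re_cinner power2_norm_eq_inner ..
  also have "\<dots> = (cmod c * norm x)\<^sup>2"
    by (simp add: complex_norm_square[symmetric] Re_cinner power2_norm_eq_inner power_mult_distrib
        del: of_real_power)
  finally show ?thesis
    by (simp add: power2_eq_iff_nonneg)
qed

lemma scaleC_scaleR_commute: "c *\<^sub>C (r *\<^sub>R x) = r *\<^sub>R (c *\<^sub>C (x::'a::complex_inner))"
  by (metis scaleC_of_real scaleC_scaleC mult.commute)

lemma bounded_linear_scaleC: "bounded_linear (\<lambda>x::'a::complex_inner. c *\<^sub>C x)"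
  by (rule bounded_linear_intro[where K="cmod c"])
    (simp_all add: scaleC_add_right scaleC_scaleR_commute norm_scaleC)

lemmas scaleC_simps = bounded_linear.linear[OF bounded_linear_scaleC, THEN linear_diff]
  bounded_linear.linear[OF bounded_linear_scaleC, THEN linear_0] scaleC_add_right scaleC_scaleR_commute

lemma bounded_ops_apply: "T \<in> bounded_ops \<Longrightarrow> blinfun_apply T (c *\<^sub>C x) = c *\<^sub>C blinfun_apply T x"
  by (simp add: bounded_ops_def)

lemma bounded_ops_intros:
  "id_blinfun \<in> bounded_ops"
  "0 \<in> bounded_ops"
  "S \<in> bounded_ops \<Longrightarrow> T \<in> bounded_ops \<Longrightarrow> S + T \<in> bounded_ops"
  "S \<in> bounded_ops \<Longrightarrow> T \<in> bounded_ops \<Longrightarrow> S - T \<in> bounded_ops"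
  "S \<in> bounded_ops \<Longrightarrow> T \<in> bounded_ops \<Longrightarrow> S o\<^sub>L T \<in> bounded_ops"
  "T \<in> bounded_ops \<Longrightarrow> r *\<^sub>R T \<in> bounded_ops"
  by (simp_all add: bounded_ops_def blinfun.bilinear_simps scaleC_simps)

text \<open>Complex-linearity has to survive norm limits because powers arise as limits of
  polynomials in the operator.\<close>

lemma bounded_ops_tendsto:
  assumes "\<And>n. S n \<in> bounded_ops" "S \<longlonglongrightarrow> T"
  shows "T \<in> bounded_ops"
  unfolding bounded_ops_def
proof (intro CollectI allI)
  fix c x
  have "(\<lambda>n. blinfun_apply (S n) (c *\<^sub>C x)) \<longlonglongrightarrow> blinfun_apply T (c *\<^sub>C x)"
    by (intro blinfun.tendsto assms tendsto_const)
  moreover have "(\<lambda>n. c *\<^sub>C blinfun_apply (S n) x) \<longlonglongrightarrow> c *\<^sub>C blinfun_apply T x"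
    by (intro bounded_linear.tendsto[OF bounded_linear_scaleC] blinfun.tendsto assms tendsto_const)
  ultimately show "blinfun_apply T (c *\<^sub>C x) = c *\<^sub>C blinfun_apply T x"
    using assms(1) by (simp add: bounded_ops_apply LIMSEQ_unique)
qed

text \<open>The imaginary part of \<open>cinner x y\<close> is the real inner product of
  \<open>(-\<i>) *\<^sub>C x\<close> with \<open>y\<close>, and a complex-linear operator commutes
  with that scaling. From here on the real inner product carries the arguments.\<close>

lemma self_adjoint_iff:
  "self_adjoint T \<longleftrightarrow> T \<in> bounded_ops \<and> (\<forall>x y. inner (blinfun_apply T x) y = inner x (blinfun_apply T y))"
proof (intro iffI conjI allI)
  assume *: "T \<in> bounded_ops \<and> (\<forall>x y. inner (blinfun_apply T x) y = inner x (blinfun_apply T y))"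
  have Im: "Im (cinner x y) = inner ((-\<i>) *\<^sub>C x) y" for x y :: 'a
    by (simp add: Re_cinner[symmetric] cinner_scaleC_left)
  show "self_adjoint T"
    unfolding self_adjoint_def complex_eq_iff Im Re_cinner
    using * by (metis bounded_ops_apply)
qed (auto simp: self_adjoint_def Re_cinner[symmetric])

lemma self_adjointD:
  assumes "self_adjoint T"
  shows "T \<in> bounded_ops" "inner (blinfun_apply T x) y = inner x (blinfun_apply T y)"
  using assms by (simp_all add: self_adjoint_iff)

lemma self_adjoint_intros:
  "self_adjoint id_blinfun"
  "self_adjoint 0"
  "self_adjoint S \<Longrightarrow> self_adjoint T \<Longrightarrow> self_adjoint (S + T)"
  "self_adjoint S \<Longrightarrow> self_adjoint T \<Longrightarrow> self_adjoint (S - T)"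
  "self_adjoint T \<Longrightarrow> self_adjoint (r *\<^sub>R T)"
  by (simp_all add: self_adjoint_iff bounded_ops_intros blinfun.bilinear_simps inner_simps)

lemma self_adjoint_compose:
  assumes "self_adjoint S" "self_adjoint T" "S o\<^sub>L T = T o\<^sub>L S"
  shows "self_adjoint (S o\<^sub>L T)"
  unfolding self_adjoint_iff
proof (intro conjI allI)
  fix x y
  have "inner ((S o\<^sub>L T) x) y = inner x ((T o\<^sub>L S) y)"
    by (simp add: self_adjointD(2)[OF assms(1)] self_adjointD(2)[OF assms(2)])
  then show "inner ((S o\<^sub>L T) x) y = inner x ((S o\<^sub>L T) y)"
    by (simp only: assms(3))
qed (use assms in \<open>simp add: self_adjointD bounded_ops_intros\<close>)

lemma self_adjoint_conjugate:
  assumes "self_adjoint Z" "self_adjoint X"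
  shows "self_adjoint (Z o\<^sub>L X o\<^sub>L Z)"
  using assms by (simp add: self_adjoint_iff bounded_ops_intros)

lemma self_adjoint_tendsto:
  assumes "\<And>n. self_adjoint (S n)" "S \<longlonglongrightarrow> T"
  shows "self_adjoint T"
  unfolding self_adjoint_iff
proof (intro conjI allI)
  show "T \<in> bounded_ops"
    using assms bounded_ops_tendsto self_adjointD(1) by blast
  fix x y
  have "(\<lambda>n. inner (blinfun_apply (S n) x) y) \<longlonglongrightarrow> inner (blinfun_apply T x) y"
    "(\<lambda>n. inner x (blinfun_apply (S n) y)) \<longlonglongrightarrow> inner x (blinfun_apply T y)"
    by (intro tendsto_inner blinfun.tendsto assms tendsto_const)+
  then show "inner (blinfun_apply T x) y = inner x (blinfun_apply T y)"
    using assms(1) by (simp add: self_adjointD(2) LIMSEQ_unique)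
qed

lemma pos_semidef_iff:
  "pos_semidef T \<longleftrightarrow> self_adjoint T \<and> (\<forall>x. 0 \<le> inner (blinfun_apply T x) x)"
  by (simp add: pos_semidef_def Re_cinner)

lemma loewner_le_iff:
  assumes "self_adjoint X" "self_adjoint Y"
  shows "X \<preceq> Y \<longleftrightarrow> (\<forall>x. inner (blinfun_apply X x) x \<le> inner (blinfun_apply Y x) x)"
  using assms
  by (simp add: loewner_le_def pos_semidef_iff self_adjoint_intros blinfun.bilinear_simps inner_simps)


section \<open>Invertibility\<close>

lemma blinfun_compose_assoc: "(R o\<^sub>L S) o\<^sub>L T = R o\<^sub>L (S o\<^sub>L T)"
  by (intro blinfun_eqI) simp

lemma blinfun_compose_id [simp]: "id_blinfun o\<^sub>L T = T" "T o\<^sub>L id_blinfun = T"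
  by (intro blinfun_eqI, simp)+

lemma is_inverse_unique:
  assumes "is_inverse T S" "is_inverse T S'"
  shows "S = S'"
  using assms unfolding is_inverse_def by (metis blinfun_compose_assoc blinfun_compose_id)

lemma op_inverse_eqI: "is_inverse T S \<Longrightarrow> op_inverse T = S"
  unfolding op_inverse_def using is_inverse_unique by blast

lemma is_inverse_sym: "T \<in> bounded_ops \<Longrightarrow> is_inverse T S \<Longrightarrow> is_inverse S T"
  by (simp add: is_inverse_def)

lemma is_inverse_apply:
  assumes "is_inverse T S"
  shows "blinfun_apply T (blinfun_apply S x) = x" "blinfun_apply S (blinfun_apply T x) = x"
  using assms unfolding is_inverse_def
  by (metis blinfun_apply_blinfun_compose blinfun_apply_id_blinfun)+

lemma is_inverse_compose:
  assumes "is_inverse S S'" "is_inverse T T'"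
  shows "is_inverse (S o\<^sub>L T) (T' o\<^sub>L S')"
  using assms by (auto simp: is_inverse_def bounded_ops_intros intro!: blinfun_eqI
      simp: is_inverse_apply[OF assms(1)] is_inverse_apply[OF assms(2)])

lemma op_invertible_compose: "op_invertible S \<Longrightarrow> op_invertible T \<Longrightarrow> op_invertible (S o\<^sub>L T)"
  using is_inverse_compose unfolding op_invertible_def by blast

lemma op_invertible_scaleR_id: "r \<noteq> 0 \<Longrightarrow> op_invertible (r *\<^sub>R id_blinfun)"
  unfolding op_invertible_def is_inverse_def
  by (rule exI[where x="inverse r *\<^sub>R id_blinfun"])
    (intro conjI blinfun_eqI bounded_ops_intros, simp_all add: blinfun.bilinear_simps)

lemma op_invertible_uminus:
  assumes "op_invertible (-T)"
  shows "op_invertible (T::'a::complex_hilbert \<Rightarrow>\<^sub>L 'a)"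
proof -
  have "T = ((-1) *\<^sub>R id_blinfun) o\<^sub>L (-T)"
    by (intro blinfun_eqI) (simp add: blinfun.bilinear_simps)
  then show ?thesis
    using op_invertible_compose[OF op_invertible_scaleR_id[of "-1"] assms] by simp
qed

text \<open>\<open>x \<mapsto> x - t (P x - y)\<close> is a contraction for small \<open>t > 0\<close>,
  so \<open>P x = y\<close> is uniquely solvable.\<close>
lemma strongly_monotone_imp_bij:
  fixes P :: "'a::complex_hilbert \<Rightarrow>\<^sub>L 'a"
  assumes "c > 0" and mono: "\<And>x. c * (norm x)\<^sup>2 \<le> inner (blinfun_apply P x) x"
  shows "\<exists>!x. blinfun_apply P x = y"
proof -
  \<comment> \<open>The choice of \<open>M\<close> gives 0 < c \<le> M, so that \<open>k\<close> is
    real and below 1. The value \<open>t\<close> minimises 1 - 2 t c + t^2 M^2, and the minimum is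
    k^2.\<close>
  define M where "M = norm P + c"
  define t where "t = c / M\<^sup>2"
  define k where "k = sqrt (1 - c\<^sup>2 / M\<^sup>2)"
  have M: "M > 0" "c \<le> M" "norm P \<le> M"
    using assms(1) by (auto simp: M_def add_nonneg_pos)
  have t: "t > 0"
    using M assms(1) by (simp add: t_def)
  have le1: "c\<^sup>2 / M\<^sup>2 \<le> 1" "c\<^sup>2 / M\<^sup>2 > 0"
    using M assms(1) by (simp_all add: power_mono)
  have k: "0 \<le> k" "k < 1" "k\<^sup>2 = 1 - c\<^sup>2 / M\<^sup>2"
    using le1 by (simp_all add: k_def)
  have contr: "norm (z - t *\<^sub>R blinfun_apply P z) \<le> k * norm z" for z
  proof (rule power2_le_imp_le)
    have "(norm (z - t *\<^sub>R blinfun_apply P z))\<^sup>2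
        = (norm z)\<^sup>2 - 2 * t * inner (blinfun_apply P z) z + t\<^sup>2 * (norm (blinfun_apply P z))\<^sup>2"
      unfolding power2_norm_eq_inner
      by (simp add: inner_simps inner_commute power2_eq_square algebra_simps)
    also have "\<dots> \<le> (norm z)\<^sup>2 - 2 * t * (c * (norm z)\<^sup>2) + t\<^sup>2 * (M * norm z)\<^sup>2"
    proof -
      have "norm (blinfun_apply P z) \<le> M * norm z"
        using norm_blinfun[of P z] M(3) by (meson mult_right_mono norm_ge_zero order_trans)
      then show ?thesis
        using t mono[of z] by (intro add_mono diff_mono mult_left_mono power_mono) auto
    qed
    also have "\<dots> = (k * norm z)\<^sup>2"
      unfolding power_mult_distrib k(3) t_def using M(1)
      by (simp add: field_simps power2_eq_square)
    finally show "(norm (z - t *\<^sub>R blinfun_apply P z))\<^sup>2 \<le> (k * norm z)\<^sup>2" .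
  qed (simp add: k)
  define g where "g x = x - t *\<^sub>R (blinfun_apply P x - y)" for x
  have "dist (g u) (g v) \<le> k * dist u v" for u v
    using contr[of "u - v"] by (simp add: g_def dist_norm blinfun.bilinear_simps algebra_simps)
  then have "\<exists>!x. g x = x"
    using banach_fix_type[OF k(1,2)] by blast
  then show ?thesis
    using t by (simp add: g_def)
qed

text \<open>Uniqueness of solutions makes the solution map additive and homogeneous, also for
  complex scalars. Cauchy-Schwarz at \<open>g y\<close> bounds it by 1/c, as in the Lax-Milgram
  theorem.\<close>

lemma strongly_monotone_invertible:
  fixes P :: "'a::complex_hilbert \<Rightarrow>\<^sub>L 'a"
  assumes P: "P \<in> bounded_ops" and c: "c > 0"
    and mono: "\<And>x. c * (norm x)\<^sup>2 \<le> inner (blinfun_apply P x) x"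
  shows "op_invertible P"
proof -
  define g where "g y = (THE x. blinfun_apply P x = y)" for y
  note ex1 = strongly_monotone_imp_bij[OF c mono]
  have Pg: "blinfun_apply P (g y) = y" for y
    unfolding g_def using theI'[OF ex1] .
  have gI: "g y = x" if "blinfun_apply P x = y" for x y
    using ex1 Pg that by blast
  have bl: "bounded_linear g"
  proof (rule bounded_linear_intro[where K="1 / c"])
    show "g (x + y) = g x + g y" "g (r *\<^sub>R x) = r *\<^sub>R g x" for x y r
      by (auto intro!: gI simp: blinfun.bilinear_simps Pg)
    show "norm (g y) \<le> norm y * (1 / c)" for y
    proof (cases "g y = 0")
      case False
      have "c * (norm (g y))\<^sup>2 \<le> norm y * norm (g y)"
        using mono[of "g y"] norm_cauchy_schwarz[of y "g y"] by (simp add: Pg)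
      then have "c * norm (g y) \<le> norm y"
        using False by (simp add: power2_eq_square)
      then show ?thesis
        using c by (simp add: field_simps)
    qed (use c in simp)
  qed
  have "is_inverse P (Blinfun g)"
    using P by (auto simp: is_inverse_def bounded_ops_def bounded_linear_Blinfun_apply[OF bl] Pg
        intro!: blinfun_eqI gI)
  then show ?thesis
    unfolding op_invertible_def by blast
qed

lemma invertible_bounded_below:
  fixes T :: "'a::complex_hilbert \<Rightarrow>\<^sub>L 'a"
  assumes "op_invertible T"
  obtains c where "c > 0" "\<And>x. c * norm x \<le> norm (blinfun_apply T x)"
proof -
  from assms obtain S where S: "is_inverse T S"
    unfolding op_invertible_def by blast
  \<comment> \<open>The summand 1 keeps the later divisor positive: on the zero space
    \<open>norm S\<close> is 0.\<close>
  have "norm x \<le> (norm S + 1) * norm (blinfun_apply T x)" for x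
  proof -
    have "norm x \<le> norm S * norm (blinfun_apply T x)"
      using norm_blinfun[of S "blinfun_apply T x"] by (simp add: is_inverse_apply[OF S])
    then show ?thesis
      by (simp add: distrib_right) (meson add_increasing2 norm_ge_zero)
  qed
  moreover have "norm S + 1 > 0"
    by (simp add: add_nonneg_pos)
  ultimately have "inverse (norm S + 1) * norm x \<le> norm (blinfun_apply T x)" for x
    by (metis divide_inverse mult.commute pos_divide_le_eq)
  then show ?thesis
    by (intro that[of "inverse (norm S + 1)"]) (simp_all add: add_nonneg_pos)
qed

text \<open>The quadratic form is nonnegative at x - s T x, which bounds norm (T x) by the form at
  x. This turns a lower bound on norm (T x), as invertibility provides, into one on the
  form.\<close>

lemma pos_semidef_norm_le:
  assumes "pos_semidef T"
  shows "(norm (blinfun_apply T x))\<^sup>2 \<le> (norm T + 1) * inner (blinfun_apply T x) x"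
proof -
  define y where "y = blinfun_apply T x"
  \<comment> \<open>With \<open>K\<close> bounding the form of \<open>T\<close> at \<open>y\<close>,
    this \<open>s\<close> minimises - 2 s + s^2 K; the summand 1 in \<open>K\<close> covers T =
    0.\<close>
  define K s where "K = norm T + 1" and "s = 1 / K"
  have K: "K > 0"
    by (simp add: K_def add_nonneg_pos)
  have Ty: "inner (blinfun_apply T y) y \<le> K * (norm y)\<^sup>2"
  proof -
    have "inner (blinfun_apply T y) y \<le> norm T * norm y * norm y"
      using norm_cauchy_schwarz[of "blinfun_apply T y" y] norm_blinfun[of T y]
      by (meson mult_right_mono norm_ge_zero order_trans)
    also have "\<dots> \<le> K * (norm y)\<^sup>2"
      by (simp add: K_def power2_eq_square algebra_simps)
    finally show ?thesis .
  qed
  have sa: "inner (blinfun_apply T y) x = inner y y"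
    using assms by (simp add: pos_semidef_iff self_adjoint_iff y_def)
  have "0 \<le> inner (blinfun_apply T (x - s *\<^sub>R y)) (x - s *\<^sub>R y)"
    using assms by (simp add: pos_semidef_iff)
  also have "\<dots> = inner y x - 2 * s * (norm y)\<^sup>2 + s\<^sup>2 * inner (blinfun_apply T y) y"
    unfolding power2_norm_eq_inner
    by (simp add: blinfun.bilinear_simps inner_simps sa y_def[symmetric] power2_eq_square algebra_simps)
  also have "\<dots> \<le> inner y x - 2 * s * (norm y)\<^sup>2 + s\<^sup>2 * (K * (norm y)\<^sup>2)"
    using Ty by (intro add_left_mono mult_left_mono) auto
  also have "\<dots> = inner y x - (norm y)\<^sup>2 / K"
    using K by (simp add: s_def field_simps power2_eq_square)
  finally show ?thesis
    using K unfolding K_def[symmetric] y_def by (simp add: field_simps)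
qed

text \<open>Invertibility bounds norm (T x) below, and \<open>pos_semidef_norm_le\<close> transfers
  this to the form; the converse is strong monotonicity.\<close>

lemma pos_def_iff:
  "T \<in> pos_def \<longleftrightarrow>
    self_adjoint T \<and> (\<exists>c>0. \<forall>x. c * (norm x)\<^sup>2 \<le> inner (blinfun_apply T x) x)"
proof
  assume T: "T \<in> pos_def"
  then have T': "pos_semidef T" "op_invertible T"
    by (simp_all add: pos_def_def)
  from T'(2) obtain c where c: "c > 0" "\<And>x. c * norm x \<le> norm (blinfun_apply T x)"
    using invertible_bounded_below by blast
  have K: "norm T + 1 > 0"
    by (simp add: add_nonneg_pos)
  have "c\<^sup>2 / (norm T + 1) * (norm x)\<^sup>2 \<le> inner (blinfun_apply T x) x" for x
  proof -
    have "(c * norm x)\<^sup>2 \<le> (norm T + 1) * inner (blinfun_apply T x) x"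
      using pos_semidef_norm_le[OF T'(1), of x] c
      by (meson less_imp_le mult_nonneg_nonneg norm_ge_zero order_trans power_mono)
    then show ?thesis
      using K by (simp add: field_simps power2_eq_square)
  qed
  then show "self_adjoint T \<and> (\<exists>c>0. \<forall>x. c * (norm x)\<^sup>2 \<le> inner (blinfun_apply T x) x)"
    using T'(1) c(1) K by (auto simp: pos_semidef_iff intro!: exI[where x="c\<^sup>2 / (norm T + 1)"])
next
  assume *: "self_adjoint T \<and> (\<exists>c>0. \<forall>x. c * (norm x)\<^sup>2 \<le> inner (blinfun_apply T x) x)"
  then obtain c where c: "c > 0" "\<And>x. c * (norm x)\<^sup>2 \<le> inner (blinfun_apply T x) x"
    by blast
  have "0 \<le> inner (blinfun_apply T x) x" for x
    using c(1) c(2)[of x] by (meson less_imp_le mult_nonneg_nonneg order_trans zero_le_power2)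
  then show "T \<in> pos_def"
    using * strongly_monotone_invertible[OF _ c] by (simp add: pos_def_def pos_semidef_iff self_adjointD)
qed


section \<open>Polynomials of an operator\<close>

text \<open>Degrees may drop under addition, so sums are compared over a common range padded with
  zero coefficients.\<close>

lemma poly_op_eq_sum:
  assumes "degree p \<le> N"
  shows "poly_op p T = (\<Sum>i\<le>N. coeff p i *\<^sub>R (((o\<^sub>L) T ^^ i) id_blinfun))"
  unfolding poly_op_def
  using assms by (intro sum.mono_neutral_left) (auto simp: coeff_eq_0)

lemma poly_op_0 [simp]: "poly_op 0 T = 0"
  by (simp add: poly_op_def)

lemma poly_op_pCons: "poly_op (pCons a p) T = a *\<^sub>R id_blinfun + (T o\<^sub>L poly_op p T)"
proof -
  have "poly_op (pCons a p) T
      = (\<Sum>i\<le>Suc (degree p). coeff (pCons a p) i *\<^sub>R (((o\<^sub>L) T ^^ i) id_blinfun))"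
    by (rule poly_op_eq_sum) (simp add: degree_pCons_le)
  also have "\<dots> = a *\<^sub>R id_blinfun + (T o\<^sub>L poly_op p T)"
    unfolding sum.atMost_Suc_shift poly_op_def
    by (intro blinfun_eqI) (simp add: blinfun.bilinear_simps blinfun.sum_left blinfun.sum_right)
  finally show ?thesis .
qed

lemma poly_op_add: "poly_op (p + q) T = poly_op p T + poly_op q T"
proof -
  define N where "N = max (degree p) (degree q)"
  have "degree (p + q) \<le> N" "degree p \<le> N" "degree q \<le> N"
    by (auto simp: N_def degree_add_le_max)
  then show ?thesis
    by (simp add: poly_op_eq_sum scaleR_add_left sum.distrib)
qed

lemma poly_op_smult: "poly_op (smult a p) T = a *\<^sub>R poly_op p T"
  by (simp add: poly_op_eq_sum[of "smult a p" "degree p"] degree_smult_le poly_op_def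
      scaleR_sum_right)

lemma poly_op_diff: "poly_op (p - q) T = poly_op p T - poly_op q T"
  using poly_op_add[of "p - q" q T] by (simp add: algebra_simps)

lemma poly_op_mult: "poly_op (p * q) T = poly_op p T o\<^sub>L poly_op q T"
proof (induction p)
  case (pCons a p)
  then show ?case
    by (intro blinfun_eqI) (simp add: poly_op_pCons poly_op_add poly_op_smult blinfun.bilinear_simps)
qed simp

lemma poly_op_const: "poly_op [:a:] T = a *\<^sub>R id_blinfun"
  by (simp add: poly_op_pCons)

lemma poly_op_ident: "poly_op [:0, 1:] T = T"
  by (simp add: poly_op_pCons)

lemma poly_op_commute:
  assumes "R o\<^sub>L T = T o\<^sub>L R"
  shows "R o\<^sub>L poly_op p T = poly_op p T o\<^sub>L R"
proof (induction p)
  case (pCons a p)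
  have "blinfun_apply R (blinfun_apply T x) = blinfun_apply T (blinfun_apply R x)"
    "blinfun_apply R (blinfun_apply (poly_op p T) x) = blinfun_apply (poly_op p T) (blinfun_apply R x)"
    for x
    using assms pCons.IH by (metis blinfun_apply_blinfun_compose)+
  then show ?case
    by (intro blinfun_eqI) (simp add: poly_op_pCons blinfun.bilinear_simps)
qed simp

lemma poly_op_self_adjoint:
  assumes "self_adjoint T"
  shows "self_adjoint (poly_op p T)"
  by (induction p)
    (simp_all add: poly_op_pCons self_adjoint_intros self_adjoint_compose assms poly_op_commute)

section \<open>Real polynomials, their complex roots, and invertibility\<close>

lemma poly_map_poly_of_real:
  "poly (map_poly of_real p) (of_real x :: complex) = of_real (poly p x)"
  by (induction p) (simp_all add: map_poly_pCons)

lemma map_poly_of_real_add_mult: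
  "map_poly (of_real :: real \<Rightarrow> complex) (p * q + r)
    = map_poly of_real p * map_poly of_real q + map_poly of_real r"
  by (rule poly_eqI) (simp add: coeff_map_poly coeff_mult)

text \<open>The quadratic is (X - z)(X - cnj z). The remainder of \<open>p\<close> modulo it is
  real, of degree at most 1, and vanishes at a nonreal point, hence is 0.\<close>

lemma complex_root_quadratic_dvd:
  fixes p :: "real poly"
  assumes root: "poly (map_poly of_real p) z = 0" and "Im z \<noteq> 0"
  shows "[:(Re z)\<^sup>2 + (Im z)\<^sup>2, - 2 * Re z, 1:] dvd p"
proof -
  define d where "d = [:(Re z)\<^sup>2 + (Im z)\<^sup>2, - 2 * Re z, 1:]"
  define r where "r = p mod d"
  have d: "d \<noteq> 0" "degree d = 2"
    by (simp_all add: d_def)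
  have d0: "poly (map_poly of_real d) z = 0"
    by (simp add: d_def map_poly_pCons complex_eq_iff power2_eq_square algebra_simps)
  have "degree r \<le> 1"
    using degree_mod_less[OF d(1), of p] d(2) by (auto simp: r_def)
  then obtain u v where r: "r = [:u, v:]"
    by (cases r rule: pCons_cases) (auto split: if_splits elim!: degree_eq_zeroE)
  have "map_poly of_real p
      = map_poly of_real (p div d) * map_poly of_real d + map_poly (of_real :: real \<Rightarrow> complex) r"
    using map_poly_of_real_add_mult[of "p div d" d r] by (simp add: r_def)
  then have "poly (map_poly of_real r) z = 0"
    using root d0 by simp
  then have "of_real u + z * of_real v = 0"
    by (simp add: r map_poly_pCons)
  then have "v = 0" "u = 0"
    using assms(2) by (auto simp: complex_eq_iff)
  then show ?thesis
    using r by (simp add: r_def d_def dvd_eq_mod_eq_0)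
qed

text \<open>This is one inclusion of the spectral mapping theorem, by splitting off one factor per
  complex root. A real root lies outside the spectrum, so its linear factor is invertible by the
  definition of \<open>real_spectrum\<close>.\<close>

lemma poly_op_invertible:
  fixes T :: "'a::complex_hilbert \<Rightarrow>\<^sub>L 'a"
  assumes T: "self_adjoint T"
  shows "p \<noteq> 0 \<Longrightarrow> (\<And>t. t \<in> real_spectrum T \<Longrightarrow> poly p t \<noteq> 0) \<Longrightarrow> op_invertible (poly_op p T)"
proof (induction "degree p" arbitrary: p rule: less_induct)
  case less
  have step: "op_invertible (poly_op p T)"
    if "d dvd p" "degree d > 0" "op_invertible (poly_op d T)" for d
  proof -
    from that(1) obtain q where q: "p = d * q"
      by blast
    have "degree q < degree p"
      using less.prems(1) that(2) by (auto simp: q degree_mult_eq)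
    then have "op_invertible (poly_op q T)"
      using less.prems by (intro less.hyps) (auto simp: q)
    then show ?thesis
      using that(3) by (simp add: q poly_op_mult op_invertible_compose)
  qed
  show ?case
  proof (cases "degree p = 0")
    case True
    then obtain a where "p = [:a:]"
      by (auto elim: degree_eq_zeroE)
    then show ?thesis
      using less.prems(1) by (simp add: poly_op_const op_invertible_scaleR_id)
  next
    case False
    then have "\<not> constant (poly (map_poly of_real p :: complex poly))"
      by (simp add: constant_degree degree_map_poly)
    then obtain z :: complex where z: "poly (map_poly of_real p) z = 0"
      using fundamental_theorem_of_algebra by blast
    show ?thesis
    proof (cases "Im z = 0")
      case True
      then have "z = of_real (Re z)"
        by (simp add: complex_eq_iff)
      then have "complex_of_real (poly p (Re z)) = 0"
        using z by (metis poly_map_poly_of_real)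
      then have root: "poly p (Re z) = 0"
        by simp
      then have "Re z \<notin> real_spectrum T"
        using less.prems(2) by blast
      then have "op_invertible (poly_op [:- Re z, 1:] T)"
        by (simp add: real_spectrum_def poly_op_pCons)
      then show ?thesis
        using root by (intro step[of "[:- Re z, 1:]"]) (simp_all add: poly_eq_0_iff_dvd)
    next
      case False
      define d where "d = [:(Re z)\<^sup>2 + (Im z)\<^sup>2, - 2 * Re z, 1:]"
      define U where "U = T - Re z *\<^sub>R id_blinfun"
      have U: "self_adjoint U"
        unfolding U_def by (intro self_adjoint_intros T)
      have "op_invertible (poly_op d T)"
      proof (rule strongly_monotone_invertible)
        show "poly_op d T \<in> bounded_ops"
          by (simp add: poly_op_self_adjoint T self_adjointD)
        show "(Im z)\<^sup>2 > 0"
          using False by simp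
        \<comment> \<open>This matches the cross term 2 (Re z) T with the two equal terms from
          expanding the square of \<open>U\<close>.\<close>
        have double: "(r * 2) *\<^sub>R y = r *\<^sub>R y + r *\<^sub>R y" for r and y :: 'a
          by (simp flip: scaleR_add_left)
        \<comment> \<open>Completing the square: since \<open>U\<close> is self-adjoint, its square
          adds norm (U x)^2 \<ge> 0 to the form, and (Im z)^2 is left as the monotonicity
          constant.\<close>
        have d: "poly_op d T = (U o\<^sub>L U) + (Im z)\<^sup>2 *\<^sub>R id_blinfun"
          by (rule blinfun_eqI) (simp add: d_def U_def poly_op_pCons blinfun.bilinear_simps
              power2_eq_square double algebra_simps)
        show "(Im z)\<^sup>2 * (norm x)\<^sup>2 \<le> inner (blinfun_apply (poly_op d T) x) x" for x
          by (simp add: d blinfun.bilinear_simps inner_simps self_adjointD(2)[OF U, of "blinfun_apply U x"]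
              power2_norm_eq_inner)
      qed
      then show ?thesis
        using complex_root_quadratic_dvd[OF z False] by (intro step[of d]) (simp_all add: d_def)
    qed
  qed
qed

text \<open>Unit vectors on which the norm of \<open>S\<close> is almost attained are approximate eigenvectors of
  \<open>S\<^sup>2\<close> for the eigenvalue \<open>(norm S)\<^sup>2\<close>.\<close>
lemma trivial_if_norm_square_not_in_spectrum:
  fixes S :: "'a::complex_hilbert \<Rightarrow>\<^sub>L 'a"
  assumes S: "self_adjoint S"
    and inv: "op_invertible ((S o\<^sub>L S) - (norm S)\<^sup>2 *\<^sub>R id_blinfun)"
  shows "(x::'a) = 0"
proof -
  define l where "l = norm S"
  define Q where "Q = (S o\<^sub>L S) - l\<^sup>2 *\<^sub>R id_blinfun"
  have "op_invertible Q"
    using inv by (simp add: Q_def l_def)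
  then obtain c where c: "c > 0" "\<And>x. c * norm x \<le> norm (blinfun_apply Q x)"
    using invertible_bounded_below by blast
  show ?thesis
  proof (cases "l = 0")
    \<comment> \<open>Here the conclusion is really reached: Q = 0 is bounded below only on the zero
      space. The other case is contradictory.\<close>
    case True
    then have "Q = 0"
      by (simp add: Q_def l_def)
    then have "c * norm x \<le> 0"
      using c(2)[of x] by simp
    then show ?thesis
      using c(1) by (simp add: mult_le_0_iff)
  next
    case False
    then have l: "l > 0"
      by (simp add: l_def)
    \<comment> \<open>Expanding norm (Q x)^2 and using norm (S (S x)) \<le> l norm (S x) turns the
      lower bound \<open>c\<close> for \<open>Q\<close> into a bound on \<open>S\<close> with a
      constant strictly below l = norm S.\<close>
    have key: "(norm (blinfun_apply S x))\<^sup>2 \<le> (l\<^sup>2 - c\<^sup>2 / l\<^sup>2) * (norm x)\<^sup>2" for x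
    proof -
      have "(norm (blinfun_apply S (blinfun_apply S x)))\<^sup>2 \<le> l\<^sup>2 * (norm (blinfun_apply S x))\<^sup>2"
        unfolding l_def power_mult_distrib[symmetric] by (intro power_mono norm_blinfun) simp
      moreover have "(norm (blinfun_apply Q x))\<^sup>2 = (norm (blinfun_apply S (blinfun_apply S x)))\<^sup>2
          - 2 * l\<^sup>2 * (norm (blinfun_apply S x))\<^sup>2 + l\<^sup>2 * l\<^sup>2 * (norm x)\<^sup>2"
        unfolding power2_norm_eq_inner Q_def
        by (simp add: blinfun.bilinear_simps inner_simps self_adjointD(2)[OF S] inner_commute algebra_simps)
      moreover have "(c * norm x)\<^sup>2 \<le> (norm (blinfun_apply Q x))\<^sup>2"
        using c by (intro power_mono) auto
      ultimately have "c\<^sup>2 * (norm x)\<^sup>2 \<le> l\<^sup>2 * (l\<^sup>2 * (norm x)\<^sup>2 - (norm (blinfun_apply S x))\<^sup>2)"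
        by (simp add: power_mult_distrib algebra_simps)
      then show ?thesis
        using l by (simp add: field_simps)
    qed
    \<comment> \<open>The maximum with 0 lets the square root be taken without deciding the sign of
      l^2 - c^2 / l^2.\<close>
    define m where "m = sqrt (max 0 (l\<^sup>2 - c\<^sup>2 / l\<^sup>2))"
    have "norm (blinfun_apply S x) \<le> m * norm x" for x
    proof (rule power2_le_imp_le)
      show "(norm (blinfun_apply S x))\<^sup>2 \<le> (m * norm x)\<^sup>2"
        using key[of x] by (simp add: m_def power_mult_distrib)
          (meson max.cobounded2 mult_right_mono order_trans zero_le_power2)
    qed (simp add: m_def)
    then have "l \<le> m"
      unfolding l_def by (intro norm_blinfun_bound) (auto simp: m_def)
    moreover have "m < l"
      unfolding m_def using l c(1) by (intro real_less_lsqrt) auto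
    ultimately show ?thesis
      by simp
  qed
qed

text \<open>A violation forces the zero space, where S = 0 contradicts l > b. The condition
  \<open>b \<ge> 0\<close> matters there, as an empty spectrum leaves \<open>b\<close>
  unconstrained.\<close>

lemma norm_poly_op_le:
  fixes T :: "'a::complex_hilbert \<Rightarrow>\<^sub>L 'a"
  assumes T: "self_adjoint T" and "b \<ge> 0"
    and b: "\<And>t. t \<in> real_spectrum T \<Longrightarrow> \<bar>poly p t\<bar> \<le> b"
  shows "norm (poly_op p T) \<le> b"
proof (rule ccontr)
  define S l where "S = poly_op p T" and "l = norm S"
  assume "\<not> norm (poly_op p T) \<le> b"
  then have l: "l > b"
    by (simp add: S_def l_def)
  define q where "q = p * p - [:l\<^sup>2:]"
  have q: "poly q t \<noteq> 0" if "t \<in> real_spectrum T" for t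
  proof -
    have "(poly p t)\<^sup>2 < l\<^sup>2"
      using b[OF that] l power_strict_mono[of "\<bar>poly p t\<bar>" l 2] by simp
    then show ?thesis
      by (simp add: q_def power2_eq_square)
  qed
  have trivial: "(x::'a) = 0" for x
  proof (cases "q = 0")
    case False
    then have "op_invertible (poly_op q T)"
      using poly_op_invertible[OF T] q by blast
    then show ?thesis
      using poly_op_self_adjoint[OF T, of p]
      by (intro trivial_if_norm_square_not_in_spectrum[of S])
        (simp_all add: q_def poly_op_diff poly_op_mult poly_op_const S_def l_def)
  next
    \<comment> \<open>The zero polynomial has no value different from 0, so the spectrum is empty.
      Any nonzero polynomial in \<open>T\<close> is then invertible, in particular T^2 - (norm
      T)^2.\<close>
    case True
    then have "real_spectrum T = {}"
      using q by auto
    then have "op_invertible (poly_op [:- (norm T)\<^sup>2, 0, 1:] T)"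
      by (intro poly_op_invertible[OF T]) simp_all
    moreover have "poly_op [:- (norm T)\<^sup>2, 0, 1:] T = (T o\<^sub>L T) - (norm T)\<^sup>2 *\<^sub>R id_blinfun"
      by (simp add: poly_op_pCons)
    ultimately show ?thesis
      using trivial_if_norm_square_not_in_spectrum[OF T] by simp
  qed
  then have "blinfun_apply S x = blinfun_apply 0 x" for x
    using trivial[of "blinfun_apply S x"] by simp
  then have "S = 0"
    by (rule blinfun_eqI)
  then show False
    using l assms(2) by (simp add: l_def)
qed


section \<open>Functional calculus\<close>

text \<open>Weierstrass approximation in the sequential form over which \<open>fun_calc\<close>
  quantifies. A compact interval stands in for the spectrum, since uniform convergence restricts to
  subsets.\<close>

lemma poly_uniform_limit:
  fixes f :: "real \<Rightarrow> real"
  assumes "continuous_on {a..b} f"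
  obtains p where "uniform_limit {a..b} (\<lambda>n. poly (p n)) f sequentially"
proof -
  have "\<exists>p. \<forall>x\<in>{a..b}. \<bar>f x - poly p x\<bar> < e" if e: "e > 0" for e
  proof -
    obtain g where g: "real_polynomial_function g" "\<And>x. x \<in> {a..b} \<Longrightarrow> \<bar>f x - g x\<bar> < e"
      using Stone_Weierstrass_real_polynomial_function[OF compact_Icc assms e] by blast
    then obtain c n where "g = (\<lambda>x. \<Sum>i\<le>n. c i * x ^ i)"
      using real_polynomial_function_iff_sum by blast
    then have "g = poly (\<Sum>i\<le>n. monom (c i) i)"
      by (simp add: fun_eq_iff poly_sum poly_monom)
    then show ?thesis
      using g(2) by blast
  qed
  then have "\<exists>p. \<forall>x\<in>{a..b}. \<bar>f x - poly p x\<bar> < inverse (real (Suc n))" for n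
    by simp
  then obtain p where p: "\<And>n x. x \<in> {a..b} \<Longrightarrow> \<bar>f x - poly (p n) x\<bar> < inverse (real (Suc n))"
    by metis
  have "uniform_limit {a..b} (\<lambda>n. poly (p n)) f sequentially"
    unfolding uniform_limit_sequentially_iff
  proof (intro allI impI)
    fix e :: real assume "e > 0"
    then obtain N where N: "inverse (real (Suc N)) < e"
      using reals_Archimedean by blast
    have "dist (poly (p n) x) (f x) < e" if "n \<ge> N" "x \<in> {a..b}" for n x
    proof -
      have "inverse (real (Suc n)) \<le> inverse (real (Suc N))"
        using that(1) by (simp add: field_simps)
      then show ?thesis
        using p[OF that(2), of n] N unfolding dist_real_def abs_minus_commute[of "f x"] by linarith
    qed
    then show "\<exists>N. \<forall>n\<ge>N. \<forall>x\<in>{a..b}. dist (poly (p n) x) (f x) < e"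
      by blast
  qed
  then show ?thesis
    using that by blast
qed

lemma poly_op_dist_le:
  assumes "self_adjoint T"
    and "\<And>t. t \<in> real_spectrum T \<Longrightarrow> dist (poly p t) (f t) < e / 2"
    and "\<And>t. t \<in> real_spectrum T \<Longrightarrow> dist (poly q t) (f t) < e / 2"
    and "e > 0"
  shows "dist (poly_op p T) (poly_op q T) \<le> e"
proof -
  have "\<bar>poly (p - q) t\<bar> \<le> e" if "t \<in> real_spectrum T" for t
    using assms(2,3)[OF that] unfolding dist_real_def poly_diff by linarith
  then have "norm (poly_op (p - q) T) \<le> e"
    using assms by (intro norm_poly_op_le) auto
  then show ?thesis
    by (simp add: poly_op_diff dist_norm)
qed

text \<open>Any two approximating sequences give operators that are close in norm: applied to
  \<open>p\<close> and itself this is the Cauchy property, applied to \<open>p\<close> and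
  \<open>q\<close> it identifies their limits. The sequence \<open>p\<close> also makes the
  described operator unique, as the defining condition would be vacuous if no sequence approximated
  \<open>f\<close>.\<close>

lemma fun_calc_tendsto:
  fixes T :: "'a::complex_hilbert \<Rightarrow>\<^sub>L 'a"
  assumes T: "self_adjoint T"
    and p: "uniform_limit (real_spectrum T) (\<lambda>n. poly (p n)) f sequentially"
  shows "(\<lambda>n. poly_op (p n) T) \<longlonglongrightarrow> fun_calc f T"
proof -
  have close: "\<exists>N. \<forall>m\<ge>N. \<forall>n\<ge>N. dist (poly_op (p m) T) (poly_op (q n) T) < e"
    if q: "uniform_limit (real_spectrum T) (\<lambda>n. poly (q n)) f sequentially" and e: "e > 0" for q e
  proof -
    \<comment> \<open>Accuracy e/4 yields the weak bound e/2, and so the strict bound e.\<close>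
    obtain M N where "\<forall>n\<ge>M. \<forall>x\<in>real_spectrum T. dist (poly (p n) x) (f x) < e / 2 / 2"
      "\<forall>n\<ge>N. \<forall>x\<in>real_spectrum T. dist (poly (q n) x) (f x) < e / 2 / 2"
      using p q e unfolding uniform_limit_sequentially_iff by (metis half_gt_zero)
    then have "dist (poly_op (p m) T) (poly_op (q n) T) \<le> e / 2" if "m \<ge> max M N" "n \<ge> max M N" for m n
      using that e by (intro poly_op_dist_le[OF T, where f=f]) auto
    then show ?thesis
      using e by (intro exI[of _ "max M N"]) (auto intro: le_less_trans[where y="e / 2"])
  qed
  have "Cauchy (\<lambda>n. poly_op (p n) T)"
    unfolding Cauchy_def using close[OF p] by blast
  then obtain S where S: "(\<lambda>n. poly_op (p n) T) \<longlonglongrightarrow> S"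
    using Cauchy_convergent convergent_def by blast
  have lim: "(\<lambda>n. poly_op (q n) T) \<longlonglongrightarrow> S"
    if q: "uniform_limit (real_spectrum T) (\<lambda>n. poly (q n)) f sequentially" for q
  proof (rule Lim_transform2[OF S])
    show "(\<lambda>n. poly_op (p n) T - poly_op (q n) T) \<longlonglongrightarrow> 0"
      unfolding LIMSEQ_iff diff_zero dist_norm[symmetric] using close[OF q] by blast
  qed
  have "fun_calc f T = S"
    unfolding fun_calc_def
    using lim S p by (intro the_equality) (auto intro: LIMSEQ_unique)
  then show ?thesis
    using S by simp
qed

lemma fun_calc_poly:
  assumes "self_adjoint T" "\<And>t. t \<in> real_spectrum T \<Longrightarrow> f t = poly p t"
  shows "fun_calc f T = poly_op p T"
proof -
  have "uniform_limit (real_spectrum T) (\<lambda>n. poly p) f sequentially"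
    by (rule uniform_limitI) (simp add: assms(2))
  from fun_calc_tendsto[OF assms(1) this] show ?thesis
    by (simp add: LIMSEQ_const_iff)
qed

text \<open>Products of uniform approximations converge uniformly because \<open>f\<close> and
  \<open>g\<close> are bounded on the interval, and composition is jointly continuous in the
  operator norm.\<close>

lemma fun_calc_mult:
  assumes T: "self_adjoint T" and spec: "real_spectrum T \<subseteq> {a..b}"
    and f: "continuous_on {a..b} f" and g: "continuous_on {a..b} g"
  shows "fun_calc (\<lambda>t. f t * g t) T = fun_calc f T o\<^sub>L fun_calc g T"
proof -
  obtain p q where "uniform_limit {a..b} (\<lambda>n. poly (p n)) f sequentially"
    "uniform_limit {a..b} (\<lambda>n. poly (q n)) g sequentially"
    using poly_uniform_limit f g by metis
  note lim = this[THEN uniform_limit_on_subset, OF spec]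
  have bdd: "bounded (h ` real_spectrum T)" if "continuous_on {a..b} h" for h :: "real \<Rightarrow> real"
    using compact_imp_bounded[OF compact_continuous_image[OF that compact_Icc]] spec
    by (meson bounded_subset image_mono)
  have "uniform_limit (real_spectrum T) (\<lambda>n. poly (p n * q n)) (\<lambda>t. f t * g t) sequentially"
    using uniform_lim_mult[OF lim bdd[OF f] bdd[OF g]] by (simp add: poly_mult[abs_def])
  then have "(\<lambda>n. poly_op (p n * q n) T) \<longlonglongrightarrow> fun_calc (\<lambda>t. f t * g t) T"
    by (rule fun_calc_tendsto[OF T])
  moreover have "(\<lambda>n. poly_op (p n) T o\<^sub>L poly_op (q n) T) \<longlonglongrightarrow> (fun_calc f T o\<^sub>L fun_calc g T)"
    by (intro bounded_bilinear.tendsto[OF bounded_bilinear_blinfun_compose] fun_calc_tendsto T lim)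
  ultimately show ?thesis
    by (simp add: poly_op_mult LIMSEQ_unique)
qed

text \<open>Outside the interval, T - t or t - T is strongly monotone, with constant a - t below and
  t - norm T above. That a > 0 makes every real power continuous on the interval.\<close>

lemma pos_def_spectrum:
  fixes T :: "'a::complex_hilbert \<Rightarrow>\<^sub>L 'a"
  assumes "T \<in> pos_def"
  obtains a b where "a > 0" "real_spectrum T \<subseteq> {a..b}"
proof -
  obtain a where T: "self_adjoint T" and a: "a > 0"
    "\<And>x. a * (norm x)\<^sup>2 \<le> inner (blinfun_apply T x) x"
    using assms by (auto simp: pos_def_iff)
  have bdd: "T - t *\<^sub>R id_blinfun \<in> bounded_ops" "t *\<^sub>R id_blinfun - T \<in> bounded_ops" for t
    using T by (simp_all add: bounded_ops_intros self_adjointD)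
  have "op_invertible (T - t *\<^sub>R id_blinfun)" if "t < a" for t
    using that a(2)
    by (intro strongly_monotone_invertible[of _ "a - t"] bdd)
      (simp_all add: blinfun.bilinear_simps inner_simps power2_norm_eq_inner algebra_simps)
  moreover have "op_invertible (T - t *\<^sub>R id_blinfun)" if "t > norm T" for t
  proof -
    have "inner (blinfun_apply T x) x \<le> norm T * (norm x)\<^sup>2" for x
    proof -
      have "inner (blinfun_apply T x) x \<le> norm (blinfun_apply T x) * norm x"
        by (rule norm_cauchy_schwarz)
      also have "\<dots> \<le> (norm T * norm x) * norm x"
        by (intro mult_right_mono norm_blinfun) simp
      finally show ?thesis
        by (simp add: power2_eq_square)
    qed
    then have "op_invertible (t *\<^sub>R id_blinfun - T)"
      using that
      by (intro strongly_monotone_invertible[of _ "t - norm T"] bdd)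
        (simp_all add: blinfun.bilinear_simps inner_simps power2_norm_eq_inner algebra_simps)
    then show ?thesis
      using op_invertible_uminus[of "T - t *\<^sub>R id_blinfun"] by simp
  qed
  ultimately have "real_spectrum T \<subseteq> {a..norm T}"
    unfolding real_spectrum_def by force
  then show ?thesis
    using that a(1) by blast
qed


section \<open>Powers of positive definite operators\<close>

lemma pos_def_self_adjoint: "T \<in> pos_def \<Longrightarrow> self_adjoint T"
  by (simp add: pos_def_iff)

text \<open>Self-adjointness and commutation pass from polynomials in \<open>T\<close> to its powers
  through this limit.\<close>

lemma op_powr_limit:
  assumes "T \<in> pos_def"
  obtains p where "(\<lambda>n. poly_op (p n) T) \<longlonglongrightarrow> op_powr T r"
proof -
  obtain a b where ab: "a > 0" "real_spectrum T \<subseteq> {a..b}"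
    using pos_def_spectrum[OF assms] .
  have "continuous_on {a..b} (\<lambda>t. t powr r)"
    using ab(1) by (intro continuous_intros) auto
  then obtain p where "uniform_limit {a..b} (\<lambda>n. poly (p n)) (\<lambda>t. t powr r) sequentially"
    by (rule poly_uniform_limit)
  then have "(\<lambda>n. poly_op (p n) T) \<longlonglongrightarrow> op_powr T r"
    unfolding op_powr_def
    by (intro fun_calc_tendsto pos_def_self_adjoint assms uniform_limit_on_subset[OF _ ab(2)])
  then show ?thesis
    by (rule that)
qed

lemma op_powr_add:
  assumes "T \<in> pos_def"
  shows "op_powr T (r + s) = op_powr T r o\<^sub>L op_powr T s"
proof -
  obtain a b where ab: "a > 0" "real_spectrum T \<subseteq> {a..b}"
    using pos_def_spectrum[OF assms] .
  show ?thesis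
    unfolding op_powr_def powr_add
    using ab(1) by (intro fun_calc_mult[OF pos_def_self_adjoint[OF assms] ab(2)] continuous_intros) auto
qed

lemma op_powr_0:
  assumes "T \<in> pos_def"
  shows "op_powr T 0 = id_blinfun"
proof -
  obtain a b where ab: "a > 0" "real_spectrum T \<subseteq> {a..b}"
    using pos_def_spectrum[OF assms] .
  \<comment> \<open>Since \<open>0 powr 0\<close> is 0, agreement with the constant 1 relies on a >
    0.\<close>
  then have "op_powr T 0 = poly_op [:1:] T"
    unfolding op_powr_def by (intro fun_calc_poly pos_def_self_adjoint assms) auto
  then show ?thesis
    by (simp add: poly_op_const)
qed

lemma op_powr_1:
  assumes "T \<in> pos_def"
  shows "op_powr T 1 = T"
proof -
  obtain a b where ab: "a > 0" "real_spectrum T \<subseteq> {a..b}"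
    using pos_def_spectrum[OF assms] .
  then have "op_powr T 1 = poly_op [:0, 1:] T"
    unfolding op_powr_def by (intro fun_calc_poly pos_def_self_adjoint assms) auto
  then show ?thesis
    by (simp add: poly_op_ident)
qed

lemma op_powr_half: "T \<in> pos_def \<Longrightarrow> op_powr T (1/2) o\<^sub>L op_powr T (1/2) = T"
  using op_powr_add[of T "1/2" "1/2"] by (simp add: op_powr_1)

lemma op_powr_self_adjoint:
  assumes "T \<in> pos_def"
  shows "self_adjoint (op_powr T r)"
  using op_powr_limit[OF assms] self_adjoint_tendsto
    poly_op_self_adjoint[OF pos_def_self_adjoint[OF assms]] by metis

lemma op_powr_is_inverse:
  assumes "T \<in> pos_def" "r + s = 0"
  shows "is_inverse (op_powr T r) (op_powr T s)"
  using op_powr_add[OF assms(1), of r s] op_powr_add[OF assms(1), of s r] assms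
    op_powr_0[OF assms(1)] self_adjointD(1)[OF op_powr_self_adjoint[OF assms(1)]]
  by (simp add: is_inverse_def add.commute)

lemma op_powr_commute:
  assumes "T \<in> pos_def" "R o\<^sub>L T = T o\<^sub>L R"
  shows "R o\<^sub>L op_powr T r = op_powr T r o\<^sub>L R"
proof -
  obtain p where p: "(\<lambda>n. poly_op (p n) T) \<longlonglongrightarrow> op_powr T r"
    using op_powr_limit[OF assms(1)] .
  have "(\<lambda>n. R o\<^sub>L poly_op (p n) T) \<longlonglongrightarrow> (R o\<^sub>L op_powr T r)"
    "(\<lambda>n. poly_op (p n) T o\<^sub>L R) \<longlonglongrightarrow> (op_powr T r o\<^sub>L R)"
    by (intro bounded_bilinear.tendsto[OF bounded_bilinear_blinfun_compose] p tendsto_const)+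
  then show ?thesis
    by (simp add: poly_op_commute[OF assms(2)] LIMSEQ_unique)
qed

lemma pos_def_conjugate:
  assumes Z: "self_adjoint Z" "op_invertible Z" and X: "X \<in> pos_def"
  shows "Z o\<^sub>L X o\<^sub>L Z \<in> pos_def"
  using assms
  by (simp add: pos_def_def pos_semidef_iff self_adjoint_conjugate op_invertible_compose
      self_adjointD(2)[OF Z(1)])

lemma pos_def_id: "id_blinfun \<in> pos_def"
  by (simp add: pos_def_iff self_adjoint_intros power2_norm_eq_inner exI[where x="1::real"])

text \<open>A power is the congruence of the identity by its own square root, the power with half
  the exponent.\<close>

lemma op_powr_pos_def:
  assumes "T \<in> pos_def"
  shows "op_powr T r \<in> pos_def"
proof -
  have "op_powr T (r/2) o\<^sub>L id_blinfun o\<^sub>L op_powr T (r/2) \<in> pos_def"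
    using op_powr_is_inverse[OF assms, of "r/2" "-r/2"]
    by (intro pos_def_conjugate op_powr_self_adjoint assms pos_def_id) (auto simp: op_invertible_def)
  then show ?thesis
    using op_powr_add[OF assms, of "r/2" "r/2"] by simp
qed

lemma op_powr_conjugate_pos_def:
  assumes "T \<in> pos_def" "X \<in> pos_def"
  shows "op_powr T r o\<^sub>L X o\<^sub>L op_powr T r \<in> pos_def"
  using op_powr_pos_def[OF assms(1), of r] assms(2)
  by (intro pos_def_conjugate) (simp_all add: pos_def_def pos_semidef_def)

text \<open>\<open>R\<close> commutes with its square \<open>T\<close>, hence with the root
  \<open>S\<close>, so (S + R)(S - R) = 0. Pairing with y = (S - R) x makes two nonnegative forms
  add up to 0, and the lower bound of \<open>R\<close> forces y = 0.\<close>

lemma op_powr_half_unique: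
  fixes R T :: "'a::complex_hilbert \<Rightarrow>\<^sub>L 'a"
  assumes R: "R \<in> pos_def" and T: "T \<in> pos_def" and sq: "R o\<^sub>L R = T"
  shows "op_powr T (1/2) = R"
proof -
  define S where "S = op_powr T (1/2)"
  have comm: "R o\<^sub>L S = S o\<^sub>L R"
    unfolding S_def using T by (rule op_powr_commute) (simp add: sq[symmetric] blinfun_compose_assoc)
  have S: "S \<in> pos_def" "S o\<^sub>L S = T"
    by (simp_all add: S_def T op_powr_half op_powr_pos_def)
  obtain c where c: "c > 0" "\<And>x. c * (norm x)\<^sup>2 \<le> inner (blinfun_apply R x) x"
    using R by (auto simp: pos_def_iff)
  have "blinfun_apply S x = blinfun_apply R x" for x
  proof -
    define y where "y = blinfun_apply S x - blinfun_apply R x"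
    have "blinfun_apply R (blinfun_apply S x) = blinfun_apply S (blinfun_apply R x)"
      "blinfun_apply S (blinfun_apply S x) = blinfun_apply R (blinfun_apply R x)"
      using comm S(2) sq by (metis blinfun_apply_blinfun_compose)+
    then have "blinfun_apply S y + blinfun_apply R y = 0"
      by (simp add: y_def blinfun.bilinear_simps)
    then have "inner (blinfun_apply S y) y + inner (blinfun_apply R y) y = 0"
      by (metis inner_add_left inner_zero_left)
    moreover have "inner (blinfun_apply S y) y \<ge> 0"
      using S(1) by (simp add: pos_def_def pos_semidef_iff)
    ultimately have "c * (norm y)\<^sup>2 \<le> 0"
      using c(2)[of y] by linarith
    then show ?thesis
      using c(1) by (simp add: y_def mult_le_0_iff)
  qed
  then show ?thesis
    unfolding S_def by (rule blinfun_eqI)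
qed

section \<open>Inverses and their square roots\<close>

lemma pos_def_is_inverse:
  assumes "T \<in> pos_def"
  shows "is_inverse T (op_inverse T)"
proof -
  obtain S where "is_inverse T S"
    using assms by (auto simp: pos_def_def op_invertible_def)
  then show ?thesis
    using op_inverse_eqI by blast
qed

lemma op_inverse_op_inverse: "T \<in> pos_def \<Longrightarrow> op_inverse (op_inverse T) = T"
  by (simp add: op_inverse_eqI is_inverse_sym pos_def_is_inverse self_adjointD(1) pos_def_self_adjoint)

lemma op_inverse_eq_op_powr:
  assumes "T \<in> pos_def"
  shows "op_inverse T = op_powr T (-1)"
  using op_powr_is_inverse[OF assms, of 1 "-1"] by (intro op_inverse_eqI) (simp add: op_powr_1 assms)

lemma op_inverse_pos_def: "T \<in> pos_def \<Longrightarrow> op_inverse T \<in> pos_def"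
  by (simp add: op_inverse_eq_op_powr op_powr_pos_def)

lemma op_powr_half_op_inverse:
  assumes "T \<in> pos_def"
  shows "op_powr (op_inverse T) (1/2) = op_powr T (-1/2)"
  using op_powr_add[OF assms, of "-1/2" "-1/2"]
  by (intro op_powr_half_unique op_powr_pos_def op_inverse_pos_def assms)
    (simp add: op_inverse_eq_op_powr assms)

lemma op_powr_minus_half_op_inverse:
  assumes "T \<in> pos_def"
  shows "op_powr (op_inverse T) (-1/2) = op_powr T (1/2)"
  using op_powr_half_op_inverse[OF op_inverse_pos_def[OF assms]]
  by (simp add: op_inverse_op_inverse assms)


section \<open>Loewner order\<close>

text \<open>The form of Z X Z at x is the form of \<open>X\<close> at Z x, and \<open>Z\<close> is
  surjective.\<close>

lemma loewner_le_conjugate: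
  fixes X Y Z :: "'a::complex_hilbert \<Rightarrow>\<^sub>L 'a"
  assumes Z: "self_adjoint Z" and inv: "op_invertible Z" and X: "self_adjoint X" and Y: "self_adjoint Y"
  shows "Z o\<^sub>L X o\<^sub>L Z \<preceq> Z o\<^sub>L Y o\<^sub>L Z \<longleftrightarrow> X \<preceq> Y"
proof -
  obtain Z' where Z': "is_inverse Z Z'"
    using inv by (auto simp: op_invertible_def)
  have surj: "(\<forall>x. P (blinfun_apply Z x)) \<longleftrightarrow> (\<forall>x. P x)" for P
    using is_inverse_apply(1)[OF Z'] by metis
  have "Z o\<^sub>L X o\<^sub>L Z \<preceq> Z o\<^sub>L Y o\<^sub>L Z \<longleftrightarrow>
      (\<forall>x. inner (blinfun_apply X (blinfun_apply Z x)) (blinfun_apply Z x)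
         \<le> inner (blinfun_apply Y (blinfun_apply Z x)) (blinfun_apply Z x))"
    by (simp add: loewner_le_iff self_adjoint_conjugate Z X Y self_adjointD(2)[OF Z])
  also have "\<dots> \<longleftrightarrow> X \<preceq> Y"
    unfolding loewner_le_iff[OF X Y] surj[of "\<lambda>y. inner (blinfun_apply X y) y \<le> inner (blinfun_apply Y y) y"] ..
  finally show ?thesis .
qed

lemma op_powr_conjugate_le:
  assumes "T \<in> pos_def" "self_adjoint X" "self_adjoint Y"
  shows "op_powr T r o\<^sub>L X o\<^sub>L op_powr T r \<preceq> op_powr T r o\<^sub>L Y o\<^sub>L op_powr T r \<longleftrightarrow> X \<preceq> Y"
  using op_powr_pos_def[OF assms(1), of r] assms(2,3)
  by (intro loewner_le_conjugate) (simp_all add: pos_def_def pos_semidef_def)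

lemma op_powr_minus_half_conjugate:
  assumes "T \<in> pos_def"
  shows "op_powr T (-1/2) o\<^sub>L T o\<^sub>L op_powr T (-1/2) = id_blinfun"
  using op_powr_add[OF assms, of "-1/2" 1] op_powr_add[OF assms, of "1/2" "-1/2"]
  by (simp add: op_powr_1 op_powr_0 assms)

text \<open>Congruence by T^(-1/2) takes I to T^(-1) and T to I.\<close>

lemma inverse_le_id_iff:
  assumes T: "T \<in> pos_def"
  shows "op_inverse T \<preceq> id_blinfun \<longleftrightarrow> id_blinfun \<preceq> T"
proof -
  have "op_inverse T = op_powr T (-1/2) o\<^sub>L id_blinfun o\<^sub>L op_powr T (-1/2)"
    using op_powr_add[OF T, of "-1/2" "-1/2"] by (simp add: op_inverse_eq_op_powr T)
  then show ?thesis
    using op_powr_conjugate_le[OF T self_adjoint_intros(1) pos_def_self_adjoint[OF T], of "-1/2"]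
    by (simp only: op_powr_minus_half_conjugate[OF T])
qed

lemma square_le_iff:
  assumes D: "D \<in> pos_def"
  shows "D o\<^sub>L D \<preceq> D \<longleftrightarrow> D \<preceq> id_blinfun"
proof -
  \<comment> \<open>Both sides are D^2: the exponents add up as 1/2 + 1 = 3/2, then 3/2 + 1/2 = 2 =
    1 + 1.\<close>
  have "op_powr D (1/2) o\<^sub>L D o\<^sub>L op_powr D (1/2) = D o\<^sub>L D"
    using op_powr_add[OF D, of "1/2" 1] op_powr_add[OF D, of "3/2" "1/2"] op_powr_add[OF D, of 1 1]
    by (simp add: op_powr_1 D)
  then show ?thesis
    using op_powr_conjugate_le[OF D pos_def_self_adjoint[OF D] self_adjoint_intros(1), of "1/2"]
    by (simp add: op_powr_half D)
qed

text \<open>D^2 \<le> I says that \<open>D\<close> does not increase norms, and Cauchy-Schwarz turns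
  this into D \<le> I. The converse chains D^2 \<le> D \<le> I.\<close>

lemma square_le_id_iff:
  assumes D: "D \<in> pos_def"
  shows "D o\<^sub>L D \<preceq> id_blinfun \<longleftrightarrow> D \<preceq> id_blinfun"
proof -
  have sa: "self_adjoint D" "self_adjoint (D o\<^sub>L D)"
    using D by (simp_all add: pos_def_self_adjoint self_adjoint_compose)
  note le = loewner_le_iff[OF sa(2) self_adjoint_intros(1)]
    loewner_le_iff[OF sa(1) self_adjoint_intros(1)] loewner_le_iff[OF sa(2,1)]
  show ?thesis
  proof
    assume *: "D o\<^sub>L D \<preceq> id_blinfun"
    have "inner (blinfun_apply D x) x \<le> inner x x" for x
    proof -
      have "inner (blinfun_apply D (blinfun_apply D x)) x \<le> inner x x"
        using * by (simp add: le)
      then have "(norm (blinfun_apply D x))\<^sup>2 \<le> (norm x)\<^sup>2"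
        using self_adjointD(2)[OF sa(1), of "blinfun_apply D x" x]
        unfolding power2_norm_eq_inner by linarith
      then have "norm (blinfun_apply D x) \<le> norm x"
        by (rule power2_le_imp_le) simp
      then have "norm (blinfun_apply D x) * norm x \<le> norm x * norm x"
        by (rule mult_right_mono) simp
      then show ?thesis
        using norm_cauchy_schwarz[of "blinfun_apply D x" x]
        by (simp add: power2_norm_eq_inner[symmetric] power2_eq_square)
    qed
    then show "D \<preceq> id_blinfun"
      by (simp add: le)
  next
    assume *: "D \<preceq> id_blinfun"
    then have "D o\<^sub>L D \<preceq> D"
      by (simp add: square_le_iff D)
    with * show "D o\<^sub>L D \<preceq> id_blinfun"
      unfolding le by (meson order_trans)
  qed
qed


section \<open>Operator means\<close>

lemma geometric_mean_pos_def:
  assumes A: "A \<in> pos_def" and B: "B \<in> pos_def"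
  shows "A \<sharp> B \<in> pos_def"
  unfolding geometric_mean_def by (intro op_powr_conjugate_pos_def op_powr_pos_def A B)

lemma op_inverse_conjugate:
  assumes "X \<in> pos_def" "is_inverse Z Z'"
  shows "op_inverse (Z o\<^sub>L X o\<^sub>L Z) = Z' o\<^sub>L op_inverse X o\<^sub>L Z'"
  using is_inverse_compose[OF is_inverse_compose[OF assms(2) pos_def_is_inverse[OF assms(1)]] assms(2)]
  by (simp add: op_inverse_eqI blinfun_compose_assoc)

text \<open>With C = A^(-1/2) B A^(-1/2), the middle term of the mean of the inverses is C^(-1)
  under the root, so each of the three factors of the mean is inverted, and their order is
  symmetric.\<close>

lemma geometric_mean_op_inverse:
  assumes A: "A \<in> pos_def" and B: "B \<in> pos_def"
  shows "op_inverse A \<sharp> op_inverse B = op_inverse (A \<sharp> B)"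
proof -
  define C where "C = op_powr A (-1/2) o\<^sub>L B o\<^sub>L op_powr A (-1/2)"
  have a: "is_inverse (op_powr A (1/2)) (op_powr A (-1/2))"
    "is_inverse (op_powr A (-1/2)) (op_powr A (1/2))"
    by (simp_all add: op_powr_is_inverse A)
  have C: "C \<in> pos_def"
    unfolding C_def by (rule op_powr_conjugate_pos_def[OF A B])
  have "op_powr A (1/2) o\<^sub>L op_inverse B o\<^sub>L op_powr A (1/2) = op_inverse C"
    unfolding C_def op_inverse_conjugate[OF B a(2)] ..
  then have "op_inverse A \<sharp> op_inverse B
      = op_powr A (-1/2) o\<^sub>L op_powr C (-1/2) o\<^sub>L op_powr A (-1/2)"
    unfolding geometric_mean_def
    using op_powr_half_op_inverse[OF C] op_powr_half_op_inverse[OF A] op_powr_minus_half_op_inverse[OF A]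
    by simp
  also have "op_powr C (-1/2) = op_inverse (op_powr C (1/2))"
    by (rule sym) (simp add: op_inverse_eqI op_powr_is_inverse C)
  also have "op_powr A (-1/2) o\<^sub>L \<dots> o\<^sub>L op_powr A (-1/2) = op_inverse (A \<sharp> B)"
    unfolding geometric_mean_def C_def[symmetric]
    by (rule op_inverse_conjugate[OF op_powr_pos_def[OF C] a(1), symmetric])
  finally show ?thesis .
qed

theorem theorem3p5:
  fixes A B :: "'a::complex_hilbert \<Rightarrow>\<^sub>L 'a"
  assumes "A \<in> pos_def" and "B \<in> pos_def"
  shows "(op_inverse A \<natural> B \<preceq> id_blinfun \<longleftrightarrow> id_blinfun \<preceq> A \<natural> op_inverse B) \<and>
         (id_blinfun \<preceq> A \<natural> op_inverse B \<longleftrightarrow> A \<sharp> B \<preceq> A) \<and>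
         (A \<sharp> B \<preceq> A \<longleftrightarrow> B \<preceq> A \<sharp> B) \<and>
         (B \<preceq> A \<sharp> B \<longleftrightarrow> B \<preceq> A)"
proof -
  note A = assms(1) and B = assms(2)
  note sa = pos_def_self_adjoint self_adjoint_intros(1)
  define G where "G = A \<sharp> B"
  have G: "G \<in> pos_def"
    unfolding G_def by (rule geometric_mean_pos_def[OF A B])
  define W where "W = op_powr G (-1/2) o\<^sub>L A o\<^sub>L op_powr G (-1/2)"
  have W: "W \<in> pos_def"
    unfolding W_def by (rule op_powr_conjugate_pos_def[OF G A])
  \<comment> \<open>The defining factor is the root of A^(-1) # B^(-1) = G^(-1), that is
    G^(-1/2).\<close>
  have 2: "A \<natural> op_inverse B = W"
    unfolding spectral_geometric_mean_def geometric_mean_op_inverse[OF A B] G_def[symmetric]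
      op_powr_half_op_inverse[OF G] W_def ..
  have "op_inverse W = op_powr G (1/2) o\<^sub>L op_inverse A o\<^sub>L op_powr G (1/2)"
    unfolding W_def by (intro op_inverse_conjugate A op_powr_is_inverse G) simp
  \<comment> \<open>Here the first argument is inverted twice, so the factor is the root of A # B =
    G itself.\<close>
  then have 1: "op_inverse A \<natural> B = op_inverse W"
    unfolding spectral_geometric_mean_def op_inverse_op_inverse[OF A] G_def by simp
  have W_iff: "id_blinfun \<preceq> W \<longleftrightarrow> G \<preceq> A"
    using op_powr_conjugate_le[OF G sa(1)[OF G] sa(1)[OF A], of "-1/2"]
    by (simp only: W_def op_powr_minus_half_conjugate[OF G])

  define C where "C = op_powr A (-1/2) o\<^sub>L B o\<^sub>L op_powr A (-1/2)"
  define D where "D = op_powr C (1/2)"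
  have C: "C \<in> pos_def"
    unfolding C_def by (rule op_powr_conjugate_pos_def[OF A B])
  have D: "D \<in> pos_def" "D o\<^sub>L D = C"
    by (simp_all add: D_def op_powr_pos_def op_powr_half C)
  let ?a = "op_powr A (1/2)"
  \<comment> \<open>In the coordinates given by congruence with A^(1/2), the operators G, A and B
    become D, I and C = D^2.\<close>
  have aG: "?a o\<^sub>L D o\<^sub>L ?a = G"
    by (simp add: G_def geometric_mean_def C_def D_def)
  have aA: "?a o\<^sub>L id_blinfun o\<^sub>L ?a = A"
    by (simp add: op_powr_half A)
  have inv: "is_inverse ?a (op_powr A (-1/2))"
    by (simp add: op_powr_is_inverse A)
  have aB: "?a o\<^sub>L C o\<^sub>L ?a = B"
    unfolding C_def by (intro blinfun_eqI)
      (simp only: blinfun_apply_blinfun_compose is_inverse_apply[OF inv])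
  note conj = op_powr_conjugate_le[OF A, where r="1/2"]
  have "G \<preceq> A \<longleftrightarrow> D \<preceq> id_blinfun"
    using conj[OF sa(1)[OF D(1)] sa(2)] by (simp only: aG aA)
  moreover have "B \<preceq> G \<longleftrightarrow> D \<preceq> id_blinfun"
    using conj[OF sa(1)[OF C] sa(1)[OF D(1)]] square_le_iff[OF D(1)] by (simp only: aG aB D(2))
  moreover have "B \<preceq> A \<longleftrightarrow> D \<preceq> id_blinfun"
    using conj[OF sa(1)[OF C] sa(2)] square_le_id_iff[OF D(1)] by (simp only: aB aA D(2))
  ultimately show ?thesis
    unfolding 1 2 inverse_le_id_iff[OF W] W_iff G_def[symmetric] by simp
qed

end
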